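(* Let $p_1=(r_1,s_1)$ and $p_2=(r_2,s_2)$ be cells of $G_{m,n}$ with $r_1\ne r_2$ and $s_1\ne s_2$, let $D=d(p_1,p_2)$, let $\delta$ be an integer with $\delta\equiv D\pmod 2$ and $-D<\delta<D$, and let \[ h=\min\bigl(d(p_1,\cdot),\,\delta+d(p_2,\cdot)\bigr). \] Call a row $i$ admissible if $i\in\{1,m\}$ or $\min(r_1,r_2)<i<\max(r_1,r_2)$, a column $j$ admissible if $j\in\{1,n\}$ or $\min(s_1,s_2)<j<\max(s_1,s_2)$, and a cell doubly admissible if its row and its column are both admissible. Call the apex with the smaller cone value at a cell the nearer apex there. Then the strict local maxima of $h$ are exactly \begin{enumerate} \item the doubly admissible cells on the ridge $\{v: d(p_1,v)=\delta+d(p_2,v)\}$, and \item the grid corners off the ridge whose nearer apex avoids (does not lie on) both sides of the grid incident to that corner. \end{enumerate}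
   Context: $G_{m,n}$ is the grid graph with vertex set (cells) $\{(i,j): 1\le i\le m,\ 1\le j\le n\}$, where $i$ is the row and $j$ the column, each vertex joined to its horizontal and vertical neighbours; $d$ is its graph distance, $d((i_1,j_1),(i_2,j_2))=|i_1-i_2|+|j_1-j_2|$. The cells $p_1,p_2$ are called the apexes; the cone values at a cell $v$ of $p_1$ and $p_2$ are $d(p_1,v)$ and $\delta+d(p_2,v)$ respectively. (The condition $-D<\delta<D$ says that both apexes are active: at each apex its own cone value is strictly the smaller of the two.) A cell $v$ is a strict local maximum of $h$ if every neighbour $u$ of $v$ satisfies $h(u)=h(v)-1$. The grid corners are $(1,1),(1,n),(m,1),(m,n)$; the sides of the grid are the row $1$, row $m$, column $1$ and column $n$, and a corner is incident to the two sides containing it (one row and one column). *)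

theory Defs
  imports Main "HOL-Number_Theory.Cong"
begin

type_synonym cell = "nat \<times> nat"

definition grid_cells :: "nat \<Rightarrow> nat \<Rightarrow> cell set" where
  "grid_cells m n = {1..m} \<times> {1..n}"

definition grid_edges :: "nat \<Rightarrow> nat \<Rightarrow> (cell \<times> cell) set" where
  "grid_edges m n = {((i, j), (i', j')).
     (i, j) \<in> grid_cells m n \<and> (i', j') \<in> grid_cells m n \<and>
     (i = i' \<and> (j' = Suc j \<or> j = Suc j') \<or> j = j' \<and> (i' = Suc i \<or> i = Suc i'))}"

text \<open>
  The graph distance is the least length of a walk: \<open>(u, v) \<in> E ^^ k\<close> says that there
  is a walk of length \<open>k\<close> from \<open>u\<close> to \<open>v\<close>. The lemma \<open>grid_dist_eq\<close> below confirms that on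
  cells of the grid it is the taxicab distance.
\<close>

definition grid_dist :: "nat \<Rightarrow> nat \<Rightarrow> cell \<Rightarrow> cell \<Rightarrow> nat" where
  "grid_dist m n u v = (LEAST k. (u, v) \<in> grid_edges m n ^^ k)"

lemma taxicab_le_walk_length:
  assumes "((i, j), (i', j')) \<in> grid_edges m n ^^ k"
  shows "\<bar>int i - int i'\<bar> + \<bar>int j - int j'\<bar> \<le> int k"
  using assms
proof (induction k arbitrary: i' j')
  case (Suc k)
  then obtain a b where "((i, j), (a, b)) \<in> grid_edges m n ^^ k"
    and e: "((a, b), (i', j')) \<in> grid_edges m n"
    by auto
  from Suc.IH[OF this(1)] e show ?case
    by (auto simp: grid_edges_def)
qed simp

lemma walk_of_taxicab_length:
  assumes "(i, j) \<in> grid_cells m n" "(i', j') \<in> grid_cells m n"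
    and "int k = \<bar>int i - int i'\<bar> + \<bar>int j - int j'\<bar>"
  shows "((i, j), (i', j')) \<in> grid_edges m n ^^ k"
  using assms
proof (induction k arbitrary: i j)
  case (Suc k)
  define a where "a = (if i < i' then Suc i else if i' < i then i - 1 else i)"
  define b where "b = (if i \<noteq> i' then j else if j < j' then Suc j else j - 1)"
  have k: "int k = \<bar>int a - int i'\<bar> + \<bar>int b - int j'\<bar>"
    using Suc.prems by (auto simp: a_def b_def grid_cells_def split: if_splits)
  have c: "(a, b) \<in> grid_cells m n"
    using Suc.prems by (auto simp: a_def b_def grid_cells_def)
  have "((i, j), (a, b)) \<in> grid_edges m n"
    using Suc.prems c by (auto simp: a_def b_def grid_edges_def grid_cells_def)
  with Suc.IH[OF c Suc.prems(2) k] show ?case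
    by (metis relpow_Suc_I2)
qed auto

lemma grid_dist_eq:
  assumes "(i, j) \<in> grid_cells m n" "(i', j') \<in> grid_cells m n"
  shows "int (grid_dist m n (i, j) (i', j')) = \<bar>int i - int i'\<bar> + \<bar>int j - int j'\<bar>"
proof -
  let ?k = "nat (\<bar>int i - int i'\<bar> + \<bar>int j - int j'\<bar>)"
  have "grid_dist m n (i, j) (i', j') = ?k"
    unfolding grid_dist_def
  proof (rule Least_equality)
    show "((i, j), (i', j')) \<in> grid_edges m n ^^ ?k"
      using assms by (intro walk_of_taxicab_length) auto
  next
    fix k assume "((i, j), (i', j')) \<in> grid_edges m n ^^ k"
    from taxicab_le_walk_length[OF this] show "?k \<le> k" by simp
  qed
  then show ?thesis by simp
qed

definition strict_local_max :: "nat \<Rightarrow> nat \<Rightarrow> (cell \<Rightarrow> int) \<Rightarrow> cell \<Rightarrow> bool" where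
  "strict_local_max m n h v \<longleftrightarrow>
     v \<in> grid_cells m n \<and> (\<forall>u. (v, u) \<in> grid_edges m n \<longrightarrow> h u = h v - 1)"

definition cone1 :: "nat \<Rightarrow> nat \<Rightarrow> cell \<Rightarrow> cell \<Rightarrow> int" where
  "cone1 m n p1 v = int (grid_dist m n p1 v)"

definition cone2 :: "nat \<Rightarrow> nat \<Rightarrow> cell \<Rightarrow> int \<Rightarrow> cell \<Rightarrow> int" where
  "cone2 m n p2 \<delta> v = \<delta> + int (grid_dist m n p2 v)"

definition ridge :: "nat \<Rightarrow> nat \<Rightarrow> cell \<Rightarrow> cell \<Rightarrow> int \<Rightarrow> cell set" where
  "ridge m n p1 p2 \<delta> = {v \<in> grid_cells m n. cone1 m n p1 v = cone2 m n p2 \<delta> v}"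

text \<open>The nearer apex is only meaningful off the ridge; on the ridge the value is junk.\<close>

definition nearer_apex :: "nat \<Rightarrow> nat \<Rightarrow> cell \<Rightarrow> cell \<Rightarrow> int \<Rightarrow> cell \<Rightarrow> cell" where
  "nearer_apex m n p1 p2 \<delta> v = (if cone1 m n p1 v < cone2 m n p2 \<delta> v then p1 else p2)"

text \<open>
  Used for rows with \<open>N = m\<close> and the row indices of the two apexes, and for columns with
  \<open>N = n\<close> and their column indices.
\<close>

definition admissible :: "nat \<Rightarrow> nat \<Rightarrow> nat \<Rightarrow> nat \<Rightarrow> bool" where
  "admissible N a b x \<longleftrightarrow> x \<in> {1, N} \<or> min a b < x \<and> x < max a b"

definition doubly_admissible :: "nat \<Rightarrow> nat \<Rightarrow> cell \<Rightarrow> cell \<Rightarrow> cell \<Rightarrow> bool" where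
  "doubly_admissible m n p1 p2 v \<longleftrightarrow>
     admissible m (fst p1) (fst p2) (fst v) \<and> admissible n (snd p1) (snd p2) (snd v)"

definition grid_corners :: "nat \<Rightarrow> nat \<Rightarrow> cell set" where
  "grid_corners m n = {(1, 1), (1, n), (m, 1), (m, n)}"

definition grid_row :: "nat \<Rightarrow> nat \<Rightarrow> nat \<Rightarrow> cell set" where
  "grid_row m n i = {v \<in> grid_cells m n. fst v = i}"

definition grid_column :: "nat \<Rightarrow> nat \<Rightarrow> nat \<Rightarrow> cell set" where
  "grid_column m n j = {v \<in> grid_cells m n. snd v = j}"

definition grid_sides :: "nat \<Rightarrow> nat \<Rightarrow> cell set set" where
  "grid_sides m n = {grid_row m n 1, grid_row m n m, grid_column m n 1, grid_column m n n}"

definition avoids_incident_sides :: "nat \<Rightarrow> nat \<Rightarrow> cell \<Rightarrow> cell \<Rightarrow> bool" where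
  "avoids_incident_sides m n c p \<longleftrightarrow> (\<forall>S \<in> grid_sides m n. c \<in> S \<longrightarrow> p \<notin> S)"

end

theory Submission
  imports Defs
begin

text \<open>
  The difference of the two cone values is even everywhere. Off the ridge it is therefore at least
  2 in absolute value, and since a step changes each cone value by one, the nearer apex still
  attains \<open>h\<close> at all neighbours; there a strict local maximum of \<open>h\<close> is one of a single
  cone. On the ridge, \<open>h\<close> drops along a step exactly when at least one of the cones does.
  Both conditions split into independent conditions on the row and on the column.
\<close>

abbreviation adjacent :: "nat \<Rightarrow> nat \<Rightarrow> bool" where
  "adjacent x y \<equiv> y = Suc x \<or> x = Suc y"

definition steps_towards :: "nat \<Rightarrow> nat \<Rightarrow> nat \<Rightarrow> bool" where
  "steps_towards a x y \<longleftrightarrow> \<bar>int y - int a\<bar> = \<bar>int x - int a\<bar> - 1"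

text \<open>There is no third case: a unit step changes the distance to \<open>a\<close> by exactly
  one, and from \<open>x = a\<close> it can only grow.\<close>

lemma abs_diff_adjacent:
  assumes "adjacent x y"
  shows "\<bar>int y - int a\<bar> = \<bar>int x - int a\<bar> + (if steps_towards a x y then - 1 else 1)"
  using assms by (auto simp: steps_towards_def)

text \<open>The two steps from an interior \<open>x\<close> go in opposite directions, so they
  cannot both approach \<open>a\<close>. An endpoint has only the inward step, which approaches
  \<open>a\<close> unless \<open>x = a\<close>. For \<open>N = 1\<close> there is no step and the
  left side would hold vacuously at \<open>x = a\<close>.\<close>

lemma all_steps_towards_one_iff:
  assumes "2 \<le> N" "x \<in> {1..N}" "a \<in> {1..N}"
  shows "(\<forall>y\<in>{1..N}. adjacent x y \<longrightarrow> steps_towards a x y) \<longleftrightarrow> x \<in> {1, N} \<and> x \<noteq> a"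
    (is "?L \<longleftrightarrow> ?R")
proof
  assume L: ?L
  have "x < N \<Longrightarrow> steps_towards a x (Suc x)" "1 < x \<Longrightarrow> steps_towards a x (x - 1)"
    using bspec[OF L, of "Suc x"] bspec[OF L, of "x - 1"] assms by (cases x; auto)+
  then show ?R
    using assms by (cases "x < N"; cases "1 < x") (auto simp: steps_towards_def)
next
  assume ?R
  then show ?L
    using assms by (auto simp: steps_towards_def)
qed

text \<open>The upward step approaches \<open>a\<close> or \<open>b\<close> iff
  \<open>x < max a b\<close>, the downward one iff \<open>min a b < x\<close>. At an endpoint only
  the inward step exists, and it succeeds because \<open>a\<close> and \<open>b\<close> cannot both
  equal \<open>x\<close>.\<close>

lemma all_steps_towards_some_iff:
  assumes "x \<in> {1..N}" "a \<in> {1..N}" "b \<in> {1..N}" "a \<noteq> b"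
  shows "(\<forall>y\<in>{1..N}. adjacent x y \<longrightarrow> steps_towards a x y \<or> steps_towards b x y)
    \<longleftrightarrow> admissible N a b x"
    (is "?L \<longleftrightarrow> ?R")
proof
  assume L: ?L
  have "x < N \<Longrightarrow> steps_towards a x (Suc x) \<or> steps_towards b x (Suc x)"
    "1 < x \<Longrightarrow> steps_towards a x (x - 1) \<or> steps_towards b x (x - 1)"
    using bspec[OF L, of "Suc x"] bspec[OF L, of "x - 1"] assms by (cases x; auto)+
  then show ?R
    using assms by (auto simp: steps_towards_def admissible_def)
next
  assume ?R
  then show ?L
    using assms by (auto simp: steps_towards_def admissible_def)
qed

text \<open>Separates vertical from horizontal neighbours, so that the one-dimensional criteria
  apply to each coordinate.\<close>

lemma strict_local_max_iff:
  assumes "(i, j) \<in> grid_cells m n"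
  shows "strict_local_max m n h (i, j) \<longleftrightarrow>
    (\<forall>i'\<in>{1..m}. adjacent i i' \<longrightarrow> h (i', j) = h (i, j) - 1) \<and>
    (\<forall>j'\<in>{1..n}. adjacent j j' \<longrightarrow> h (i, j') = h (i, j) - 1)"
  using assms unfolding strict_local_max_def grid_edges_def grid_cells_def by auto

lemma avoids_incident_sides_corner:
  assumes "2 \<le> m" "2 \<le> n" "(r, s) \<in> grid_cells m n" "(i, j) \<in> grid_corners m n"
  shows "avoids_incident_sides m n (i, j) (r, s) \<longleftrightarrow> i \<noteq> r \<and> j \<noteq> s"
  using assms
  by (auto simp: avoids_incident_sides_def grid_sides_def grid_row_def grid_column_def
      grid_cells_def grid_corners_def)

text \<open>\<open>A\<close>, \<open>B\<close> stand for the cone values at a cell and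
  \<open>A'\<close>, \<open>B'\<close> for those at a neighbour. From a tie, the smaller new value
  is \<open>A - 1\<close> as soon as one of the two falls.\<close>

lemma min_drop_on_ridge:
  fixes A B A' B' :: int
  assumes "A = B" "A' = A + (if P then - 1 else 1)" "B' = B + (if Q then - 1 else 1)"
  shows "min A' B' = min A B - 1 \<longleftrightarrow> P \<or> Q"
  using assms by auto

text \<open>Here \<open>B' \<ge> B - 1 \<ge> A + 1 \<ge> A'\<close>, so \<open>A'\<close> is the new
  minimum whatever \<open>Q\<close> is.\<close>

lemma min_drop_off_ridge:
  fixes A B A' B' :: int
  assumes "A + 2 \<le> B" "A' = A + (if P then - 1 else 1)" "B' = B + (if Q then - 1 else 1)"
  shows "min A' B' = min A B - 1 \<longleftrightarrow> P"
  using assms by auto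

theorem lemma3p10:
  fixes m n r1 s1 r2 s2 :: nat and p1 p2 :: cell and D \<delta> :: int and h :: "cell \<Rightarrow> int"
  assumes "p1 = (r1, s1)" and "p2 = (r2, s2)"
    and "p1 \<in> grid_cells m n" and "p2 \<in> grid_cells m n"
    and "r1 \<noteq> r2" and "s1 \<noteq> s2"
    and "D = int (grid_dist m n p1 p2)"
    and "[\<delta> = D] (mod 2)" and "- D < \<delta>" and "\<delta> < D"
    and "h = (\<lambda>v. min (cone1 m n p1 v) (cone2 m n p2 \<delta> v))"
  shows "{v. strict_local_max m n h v} =
    {v \<in> ridge m n p1 p2 \<delta>. doubly_admissible m n p1 p2 v} \<union>
    {v \<in> grid_corners m n. v \<notin> ridge m n p1 p2 \<delta> \<and>
       avoids_incident_sides m n v (nearer_apex m n p1 p2 \<delta> v)}"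
proof -
  have r: "r1 \<in> {1..m}" "r2 \<in> {1..m}" and s: "s1 \<in> {1..n}" "s2 \<in> {1..n}"
    using assms(1-4) by (auto simp: grid_cells_def)
  have m: "2 \<le> m" and n: "2 \<le> n"
    using r s assms(5,6) by auto
  have corners: "grid_corners m n \<subseteq> grid_cells m n"
    using m n by (auto simp: grid_corners_def grid_cells_def)
  have c1: "cone1 m n p1 (i, j) = \<bar>int i - int r1\<bar> + \<bar>int j - int s1\<bar>"
    and c2: "cone2 m n p2 \<delta> (i, j) = \<delta> + (\<bar>int i - int r2\<bar> + \<bar>int j - int s2\<bar>)"
    if "(i, j) \<in> grid_cells m n" for i j
    using that assms(1-4)
    by (simp_all add: cone1_def cone2_def grid_dist_eq abs_minus_commute)
  have D: "D = \<bar>int r1 - int r2\<bar> + \<bar>int s1 - int s2\<bar>"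
    using assms(1-4,7) by (simp add: grid_dist_eq)
  have "strict_local_max m n h (i, j) \<longleftrightarrow>
      (i, j) \<in> ridge m n p1 p2 \<delta> \<and> doubly_admissible m n p1 p2 (i, j) \<or>
      (i, j) \<in> grid_corners m n \<and> (i, j) \<notin> ridge m n p1 p2 \<delta> \<and>
        avoids_incident_sides m n (i, j) (nearer_apex m n p1 p2 \<delta> (i, j))"
    (is "_ \<longleftrightarrow> ?rhs") if c: "(i, j) \<in> grid_cells m n" for i j
  proof -
    have ij: "i \<in> {1..m}" "j \<in> {1..n}"
      using c by (auto simp: grid_cells_def)
    let ?A = "cone1 m n p1" and ?B = "cone2 m n p2 \<delta>"
    \<comment> \<open>A vertical step keeps the column term of the taxicab distance, so only the row
      term of each cone changes.\<close>
    have row: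
      "?A (i', j) = ?A (i, j) + (if steps_towards r1 i i' then - 1 else 1)"
      "?B (i', j) = ?B (i, j) + (if steps_towards r2 i i' then - 1 else 1)"
      if "i' \<in> {1..m}" "adjacent i i'" for i'
      using that(1) ij abs_diff_adjacent[OF that(2)] by (auto simp: c1 c2 grid_cells_def)
    have col:
      "?A (i, j') = ?A (i, j) + (if steps_towards s1 j j' then - 1 else 1)"
      "?B (i, j') = ?B (i, j) + (if steps_towards s2 j j' then - 1 else 1)"
      if "j' \<in> {1..n}" "adjacent j j'" for j'
      using that(1) ij abs_diff_adjacent[OF that(2)] by (auto simp: c1 c2 grid_cells_def)
    have corner: "(i, j) \<in> grid_corners m n \<longleftrightarrow> i \<in> {1, m} \<and> j \<in> {1, n}"
      by (auto simp: grid_corners_def)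
    have parity: "even (?A (i, j) - ?B (i, j))"
      using assms(8) unfolding c1[OF c] c2[OF c] D cong_iff_dvd_diff by simp presburger
    consider "?A (i, j) = ?B (i, j)" | "?A (i, j) < ?B (i, j)" | "?B (i, j) < ?A (i, j)"
      by linarith
    then show ?thesis
    proof cases
      case 1
      have "strict_local_max m n h (i, j) \<longleftrightarrow>
          admissible m r1 r2 i \<and> admissible n s1 s2 j"
        using min_drop_on_ridge[OF 1 row] min_drop_on_ridge[OF 1 col]
          all_steps_towards_some_iff[OF ij(1) r assms(5)]
          all_steps_towards_some_iff[OF ij(2) s assms(6)]
        unfolding strict_local_max_iff[OF c] assms(11) by auto
      then show ?thesis
        using 1 c assms(1,2) by (simp add: ridge_def doubly_admissible_def)
    next
      case 2
      \<comment> \<open>A positive even difference is at least 2.\<close>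
      then have gap: "?A (i, j) + 2 \<le> ?B (i, j)"
        using parity by presburger
      have "strict_local_max m n h (i, j) \<longleftrightarrow>
          (i \<in> {1, m} \<and> i \<noteq> r1) \<and> (j \<in> {1, n} \<and> j \<noteq> s1)"
        using min_drop_off_ridge[OF gap row] min_drop_off_ridge[OF gap col]
        unfolding strict_local_max_iff[OF c] assms(11)
          all_steps_towards_one_iff[OF m ij(1) r(1), symmetric]
          all_steps_towards_one_iff[OF n ij(2) s(1), symmetric] by auto
      also have "\<dots> \<longleftrightarrow> (i, j) \<in> grid_corners m n \<and> avoids_incident_sides m n (i, j) p1"
        using avoids_incident_sides_corner[OF m n] assms(1,3) corner by blast
      finally show ?thesis
        using 2 by (simp add: ridge_def nearer_apex_def)
    next
      case 3
      then have gap: "?B (i, j) + 2 \<le> ?A (i, j)"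
        using parity by presburger
      have "strict_local_max m n h (i, j) \<longleftrightarrow>
          (i \<in> {1, m} \<and> i \<noteq> r2) \<and> (j \<in> {1, n} \<and> j \<noteq> s2)"
        \<comment> \<open>The second cone is now the lower one, so the two cones swap roles;
          \<open>min.commute\<close> reorders \<open>h\<close> to match, at the cell and at its
          neighbours alike.\<close>
        using min_drop_off_ridge[OF gap row(2,1)] min_drop_off_ridge[OF gap col(2,1)]
        unfolding strict_local_max_iff[OF c] assms(11)
          min.commute[of "cone1 m n p1 v" "cone2 m n p2 \<delta> v" for v]
          all_steps_towards_one_iff[OF m ij(1) r(2), symmetric]
          all_steps_towards_one_iff[OF n ij(2) s(2), symmetric] by auto
      also have "\<dots> \<longleftrightarrow> (i, j) \<in> grid_corners m n \<and> avoids_incident_sides m n (i, j) p2"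
        using avoids_incident_sides_corner[OF m n] assms(2,4) corner by blast
      finally show ?thesis
        using 3 by (simp add: ridge_def nearer_apex_def)
    qed
  qed
  then have "strict_local_max m n h v \<longleftrightarrow>
      v \<in> ridge m n p1 p2 \<delta> \<and> doubly_admissible m n p1 p2 v \<or>
      v \<in> grid_corners m n \<and> v \<notin> ridge m n p1 p2 \<delta> \<and>
        avoids_incident_sides m n v (nearer_apex m n p1 p2 \<delta> v)"
    if "v \<in> grid_cells m n" for v
    using that by (cases v) blast
  \<comment> \<open>The sets range over all pairs of naturals; outside the grid neither side of the
    equation has elements.\<close>
  moreover have "v \<notin> {v. strict_local_max m n h v}" "v \<notin> ridge m n p1 p2 \<delta>"
    "v \<notin> grid_corners m n"
    if "v \<notin> grid_cells m n" for v
    using that corners by (auto simp: strict_local_max_def ridge_def)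
  ultimately show ?thesis
    by blast
qed

end
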